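(* Let $n\ge2$ and let $P\in\mathcal I(n)$ be nonzero and indecomposable. Then $$\operatorname{p-degree}(P)\le (n-1)\,(2N(P)-5).$$
   Context: $S(X)=X_0+X_1+\dots+X_n$. $\mathcal I(n)$ denotes the set of homogeneous polynomials $P\in\mathbb R[X_0,\dots,X_n]$ with $P(X)=0$ whenever $S(X)=0$. $N(P)$ is the number of distinct monomials of $P$ with nonzero coefficient. The p-degree of $P$ is the smallest integer $d$ such that $P=X^\alpha R$ for some monomial $X^\alpha$ and some polynomial $R$ of degree $d$. $P\in\mathcal I(n)$ is indecomposable if one cannot write $P=P_1+P_2$ with $P_1,P_2\in\mathcal I(n)$ both nonzero and having no monomial in common. *)

theory Defs
  imports Complex_Main
begin

(* A polynomial in R[X_0,...,X_n] is represented by its coefficient function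
   on exponent vectors alpha :: nat => nat (alpha i = exponent of X_i). *)

definition supp :: "((nat \<Rightarrow> nat) \<Rightarrow> real) \<Rightarrow> (nat \<Rightarrow> nat) set" where
  "supp P = {\<alpha>. P \<alpha> \<noteq> 0}"

definition is_poly :: "nat \<Rightarrow> ((nat \<Rightarrow> nat) \<Rightarrow> real) \<Rightarrow> bool" where
  "is_poly n P \<longleftrightarrow> finite (supp P) \<and> (\<forall>\<alpha>\<in>supp P. \<forall>i>n. \<alpha> i = 0)"

definition tdeg :: "nat \<Rightarrow> (nat \<Rightarrow> nat) \<Rightarrow> nat" where
  "tdeg n \<alpha> = (\<Sum>i\<le>n. \<alpha> i)"

definition peval :: "nat \<Rightarrow> ((nat \<Rightarrow> nat) \<Rightarrow> real) \<Rightarrow> (nat \<Rightarrow> real) \<Rightarrow> real" where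
  "peval n P x = (\<Sum>\<alpha>\<in>supp P. P \<alpha> * (\<Prod>i\<le>n. x i ^ \<alpha> i))"

definition homogeneous :: "nat \<Rightarrow> ((nat \<Rightarrow> nat) \<Rightarrow> real) \<Rightarrow> bool" where
  "homogeneous n P \<longleftrightarrow> (\<exists>d. \<forall>\<alpha>\<in>supp P. tdeg n \<alpha> = d)"

definition in_I :: "nat \<Rightarrow> ((nat \<Rightarrow> nat) \<Rightarrow> real) \<Rightarrow> bool" where
  "in_I n P \<longleftrightarrow> is_poly n P \<and> homogeneous n P \<and>
     (\<forall>x::nat \<Rightarrow> real. (\<Sum>i\<le>n. x i) = 0 \<longrightarrow> peval n P x = 0)"

definition Nmon :: "((nat \<Rightarrow> nat) \<Rightarrow> real) \<Rightarrow> nat" where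
  "Nmon P = card (supp P)"

definition poly_degree :: "nat \<Rightarrow> ((nat \<Rightarrow> nat) \<Rightarrow> real) \<Rightarrow> nat" where
  "poly_degree n R = Max (insert 0 (tdeg n ` supp R))"

definition mono_mult :: "(nat \<Rightarrow> nat) \<Rightarrow> ((nat \<Rightarrow> nat) \<Rightarrow> real) \<Rightarrow> ((nat \<Rightarrow> nat) \<Rightarrow> real)" where
  "mono_mult \<beta> R = (\<lambda>\<alpha>. if (\<forall>i. \<beta> i \<le> \<alpha> i) then R (\<lambda>i. \<alpha> i - \<beta> i) else 0)"

definition pdegree :: "nat \<Rightarrow> ((nat \<Rightarrow> nat) \<Rightarrow> real) \<Rightarrow> nat" where
  "pdegree n P = (LEAST d. \<exists>\<beta> R. (\<forall>i>n. \<beta> i = 0) \<and> is_poly n R \<and>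
       poly_degree n R = d \<and> P = mono_mult \<beta> R)"

definition indecomposable :: "nat \<Rightarrow> ((nat \<Rightarrow> nat) \<Rightarrow> real) \<Rightarrow> bool" where
  "indecomposable n P \<longleftrightarrow> in_I n P \<and>
     \<not> (\<exists>P1 P2. in_I n P1 \<and> in_I n P2 \<and> P1 \<noteq> (\<lambda>_. 0) \<and> P2 \<noteq> (\<lambda>_. 0) \<and>
          supp P1 \<inter> supp P2 = {} \<and> P = (\<lambda>\<alpha>. P1 \<alpha> + P2 \<alpha>))"

end

theory Submission
  imports Defs "HOL-Computational_Algebra.Polynomial"
begin

text \<open>
  Write \<open>P = S Q\<close>. Indecomposability makes the support of \<open>Q\<close> connected under the moves
  \<open>\<alpha> \<mapsto> \<alpha> + e\<^sub>k - e\<^sub>l\<close>. Fix two variables and evaluate the others at a generic positive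
  point: \<open>Q\<close> becomes a finite signed connected set \<open>W\<close> in the planar triangular lattice, and a
  monomial of \<open>P\<close> lies over every point \<open>u\<close> such that the values at \<open>u\<close>, \<open>u - e\<^sub>1\<close>, \<open>u - e\<^sub>2\<close>
  do not all vanish and the nonzero ones have the same sign. Every lattice edge lies in exactly one triangle
  \<open>u, u - e\<^sub>1, u - e\<^sub>2\<close> and in exactly one triangle \<open>u, u + e\<^sub>1, u + e\<^sub>2\<close>, and a triangle has at most two edges with
  opposite signs. This double count bounds the number of these monomials from below by numbers of
  boundary points of \<open>W\<close>, and connectedness bounds those by the side length \<open>D\<close> of the
  triangle circumscribed about \<open>W\<close>: \<open>D + 6 \<le> 2 N(P)\<close>. Adding up such bounds over pairs
  of variables gives the theorem.
\<close>

section \<open>Sign patterns on the triangular lattice\<close>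

text \<open>Translation lets an edge or a lone point be charged to any of the triangles containing
  it. One finite set \<open>B\<close> serves all sums, without being translation invariant:
  containing the support of \<open>g\<close> and its translate is enough.\<close>

lemma sum_shift_invariant:
  fixes g :: "int \<Rightarrow> int \<Rightarrow> int"
  assumes "finite B" and B: "\<And>a b. g a b \<noteq> 0 \<Longrightarrow> (a, b) \<in> B \<and> (a - c, b - d) \<in> B"
  shows "(\<Sum>(a, b)\<in>B. g (a + c) (b + d)) = (\<Sum>(a, b)\<in>B. g a b)"
proof -
  let ?G = "{(a, b). g a b \<noteq> 0}" and ?H = "{(a, b). g (a + c) (b + d) \<noteq> 0}"
  have "(\<Sum>(a, b)\<in>B. g (a + c) (b + d)) = (\<Sum>(a, b)\<in>?H. g (a + c) (b + d))"
    using \<open>finite B\<close> B by (intro sum.mono_neutral_right) fastforce+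
  also have "\<dots> = (\<Sum>(a, b)\<in>?G. g a b)"
    by (rule sum.reindex_bij_witness[of _ "\<lambda>(a, b). (a - c, b - d)" "\<lambda>(a, b). (a + c, b + d)"]) auto
  also have "\<dots> = (\<Sum>(a, b)\<in>B. g a b)"
    using \<open>finite B\<close> B by (intro sum.mono_neutral_left) auto
  finally show ?thesis .
qed

lemma int_card_eq_sum_indicator:
  assumes "finite B" and "A \<subseteq> B"
  shows "int (card A) = (\<Sum>u\<in>B. if u \<in> A then 1 else 0)"
  using assms by (simp add: sum.If_cases Int_absorb1)

text \<open>
  The first three sets correspond to the triangles \<open>u, u - e\<^sub>1, u - e\<^sub>2\<close> that meet \<open>W\<close> in
  exactly one point, sorted by that point; \<open>lone_high\<close> belongs to the triangles
  \<open>u, u + e\<^sub>1, u + e\<^sub>2\<close> meeting \<open>W\<close> in \<open>u\<close> only.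
\<close>

definition lone_low :: "(int \<times> int) set \<Rightarrow> (int \<times> int) set" where
  "lone_low W = {(a, b) \<in> W. (a - 1, b) \<notin> W \<and> (a, b - 1) \<notin> W}"

definition lone_right :: "(int \<times> int) set \<Rightarrow> (int \<times> int) set" where
  "lone_right W = {(a, b) \<in> W. (a + 1, b) \<notin> W \<and> (a + 1, b - 1) \<notin> W}"

definition lone_top :: "(int \<times> int) set \<Rightarrow> (int \<times> int) set" where
  "lone_top W = {(a, b) \<in> W. (a, b + 1) \<notin> W \<and> (a - 1, b + 1) \<notin> W}"

definition lone_high :: "(int \<times> int) set \<Rightarrow> (int \<times> int) set" where
  "lone_high W = {(a, b) \<in> W. (a + 1, b) \<notin> W \<and> (a, b + 1) \<notin> W}"

definition unmixed :: "real \<Rightarrow> real \<Rightarrow> real \<Rightarrow> bool" where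
  "unmixed x y z \<longleftrightarrow> (x \<noteq> 0 \<or> y \<noteq> 0 \<or> z \<noteq> 0) \<and> ((0 \<le> x \<and> 0 \<le> y \<and> 0 \<le> z) \<or> (x \<le> 0 \<and> y \<le> 0 \<and> z \<le> 0))"

definition nodes :: "(int \<Rightarrow> int \<Rightarrow> real) \<Rightarrow> (int \<times> int) set" where
  "nodes r = {(a, b). unmixed (r a b) (r (a - 1) b) (r a (b - 1))}"

definition int_sign :: "real \<Rightarrow> int" where "int_sign x = (if x > 0 then 1 else if x < 0 then -1 else 0)"

text \<open>By cases on the signs at \<open>u\<close>, \<open>u - e1\<close>, \<open>u - e2\<close>:
  the left side is 4 for a single nonzero value, 2 for two equal signs, 6 - 2 for three equal signs,
  and 0 for every triangle with opposite signs.\<close>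

lemma unmixed_weight_le:
  fixes x y z :: real
  defines "X \<equiv> int_sign x" and "Y \<equiv> int_sign y" and "Z \<equiv> int_sign z"
  shows "4 * (\<bar>X\<bar> * (1 - \<bar>Y\<bar>) * (1 - \<bar>Z\<bar>) + \<bar>Y\<bar> * (1 - \<bar>X\<bar>) * (1 - \<bar>Z\<bar>) + \<bar>Z\<bar> * (1 - \<bar>X\<bar>) * (1 - \<bar>Y\<bar>))
     + ((X * Y + \<bar>X * Y\<bar>) + (X * Z + \<bar>X * Z\<bar>) + (Y * Z + \<bar>Y * Z\<bar>)) - 2 * \<bar>X * Y * Z\<bar>
    \<le> 4 * (if unmixed x y z then 1 else 0)"
  unfolding X_def Y_def Z_def int_sign_def unmixed_def by (simp split: if_splits)

text \<open>Among three nonzero signs two agree.\<close>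

lemma pair_sum_ge:
  fixes x y z :: real
  defines "X \<equiv> int_sign x" and "Y \<equiv> int_sign y" and "Z \<equiv> int_sign z"
  shows "2 * \<bar>X * Y * Z\<bar> \<le> (X * Y + \<bar>X * Y\<bar>) + (X * Z + \<bar>X * Z\<bar>) + (Y * Z + \<bar>Y * Z\<bar>)"
  unfolding X_def Y_def Z_def int_sign_def by (simp split: if_splits)

text \<open>Sum \<open>unmixed_weight_le\<close> over all triangles
  \<open>u, u - e1, u - e2\<close>. The edges with equal signs, regrouped into the triangles
  \<open>u, u + e1, u + e2\<close>, are bounded below by \<open>pair_sum_ge\<close>. What remains of
  the full triangles is \<open>V' - V\<close>, which equals the number of \<open>lone_high\<close>
  points minus that of \<open>lone_low\<close> points.\<close>

lemma nodes_lower_bound: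
  fixes r :: "int \<Rightarrow> int \<Rightarrow> real"
  defines "W \<equiv> {(a, b). r a b \<noteq> 0}"
  assumes fin: "finite W"
  shows "card (lone_low W) + 2 * card (lone_right W) + 2 * card (lone_top W) + card (lone_high W)
    \<le> 2 * card (nodes r)"
proof -
  \<comment> \<open>All points within distance 2 of \<open>W\<close> in each coordinate: outside
    this set every summand below vanishes, before and after the shifts.\<close>
  define B where "B = (\<lambda>((a, b), (c, d)). (a - c, b - d)) ` (W \<times> ({-2..2} \<times> {-2..2::int}))"
  have finB: "finite B" unfolding B_def using fin by auto
  have inB: "(a, b) \<in> B" if "r (a + c) (b + d) \<noteq> 0" "\<bar>c\<bar> \<le> 2" "\<bar>d\<bar> \<le> 2" for a b c d
  proof -
    have "((a + c, b + d), (c, d)) \<in> W \<times> ({-2..2} \<times> {-2..2})" using that by (auto simp: W_def)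
    then show ?thesis unfolding B_def by (rule rev_image_eqI) auto
  qed
  have inB': "(a, b) \<in> B" if "r a' b' \<noteq> 0" "\<bar>a' - a\<bar> \<le> 2" "\<bar>b' - b\<bar> \<le> 2" for a b a' b'
    using inB[of a "a' - a" b "b' - b"] that by auto
  define s where "s = (\<lambda>a b. int_sign (r a b))"
  define w where "w = (\<lambda>a b. \<bar>s a b\<bar>)"
  have s0: "s a b = 0 \<longleftrightarrow> r a b = 0" for a b by (auto simp: s_def int_sign_def)
  have w: "w a b = (if (a, b) \<in> W then 1 else 0)" for a b
    by (auto simp: w_def s_def int_sign_def W_def)
  \<comment> \<open>twice the indicator of an edge with equal signs at its ends\<close>
  define p where "p = (\<lambda>a b a' b'. s a b * s a' b' + \<bar>s a b * s a' b'\<bar>)"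
  note shift = sum_shift_invariant[OF finB]
  have low: "int (card (lone_low W)) = (\<Sum>(a,b)\<in>B. w a b * (1 - w (a-1) b) * (1 - w a (b-1)))"
    by (subst int_card_eq_sum_indicator[OF finB])
       (auto simp: lone_low_def w W_def intro!: sum.cong intro: inB')
  have right: "int (card (lone_right W)) = (\<Sum>(a,b)\<in>B. w a b * (1 - w (a+1) b) * (1 - w (a+1) (b-1)))"
    by (subst int_card_eq_sum_indicator[OF finB])
       (auto simp: lone_right_def w W_def intro!: sum.cong intro: inB')
  \<comment> \<open>A \<open>lone_right\<close> point is the vertex \<open>u - e1\<close> of its
    triangle; the shift re-indexes the sum by \<open>u\<close>, as the local inequality
    requires.\<close>
  have right': "\<dots> = (\<Sum>(a,b)\<in>B. w (a-1) b * (1 - w a b) * (1 - w a (b-1)))"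
    by (subst shift[where c="-1" and d=0, symmetric]) (auto simp: w W_def split: if_splits intro: inB')
  have top: "int (card (lone_top W)) = (\<Sum>(a,b)\<in>B. w a b * (1 - w a (b+1)) * (1 - w (a-1) (b+1)))"
    by (subst int_card_eq_sum_indicator[OF finB])
       (auto simp: lone_top_def w W_def intro!: sum.cong intro: inB')
  have top': "\<dots> = (\<Sum>(a,b)\<in>B. w a (b-1) * (1 - w a b) * (1 - w (a-1) b))"
    by (subst shift[where c=0 and d="-1", symmetric]) (auto simp: w W_def split: if_splits intro: inB')
  have high: "int (card (lone_high W)) = (\<Sum>(a,b)\<in>B. w a b * (1 - w (a+1) b) * (1 - w a (b+1)))"
    by (subst int_card_eq_sum_indicator[OF finB])
       (auto simp: lone_high_def w W_def intro!: sum.cong intro: inB')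
  have nodes: "int (card (nodes r)) =
      (\<Sum>(a,b)\<in>B. if unmixed (r a b) (r (a-1) b) (r a (b-1)) then 1 else 0)"
    by (subst int_card_eq_sum_indicator[OF finB])
       (auto simp: nodes_def unmixed_def intro!: sum.cong intro: inB')
  define V where "V = (\<Sum>(a,b)\<in>B. \<bar>s a b * s (a-1) b * s a (b-1)\<bar>)"
  define V' where "V' = (\<Sum>(a,b)\<in>B. \<bar>s a b * s (a+1) b * s a (b+1)\<bar>)"
  have p0: "r a b \<noteq> 0 \<and> r a' b' \<noteq> 0" if "p a b a' b' \<noteq> 0" for a b a' b'
    using that by (auto simp: p_def s0[symmetric])
  have p_comm: "p a b a' b' = p a' b' a b" for a b a' b' by (simp add: p_def mult.commute)
  \<comment> \<open>For each of the three edge directions, summing over downward or over upward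
    triangles counts the same edges.\<close>
  have e1: "(\<Sum>(a,b)\<in>B. p a b (a-1) b) = (\<Sum>(a,b)\<in>B. p a b (a+1) b)"
    by (subst shift[where g="\<lambda>a b. p a b (a-1) b" and c=1 and d=0, symmetric]) (auto simp: p_comm[of "_ + 1"] dest!: p0 intro: inB')
  have e2: "(\<Sum>(a,b)\<in>B. p a b a (b-1)) = (\<Sum>(a,b)\<in>B. p a b a (b+1))"
    by (subst shift[where g="\<lambda>a b. p a b a (b-1)" and c=0 and d=1, symmetric]) (auto simp: p_comm[of _ "_ + 1"] dest!: p0 intro: inB')
  have e3: "(\<Sum>(a,b)\<in>B. p (a-1) b a (b-1)) = (\<Sum>(a,b)\<in>B. p (a+1) b a (b+1))"
    by (subst shift[where g="\<lambda>a b. p (a-1) b a (b-1)" and c=1 and d=1, symmetric]) (auto simp: p_comm[of _ "_ + 1"] dest!: p0 intro: inB')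
  have w0: "r a b \<noteq> 0" if "w a b \<noteq> 0" for a b
    using that by (auto simp: w_def s0)
  have w1: "(\<Sum>(a,b)\<in>B. w a b * w (a-1) b) = (\<Sum>(a,b)\<in>B. w a b * w (a+1) b)"
    by (subst shift[where g="\<lambda>a b. w a b * w (a-1) b" and c=1 and d=0, symmetric]) (auto simp: mult.commute dest!: w0 intro: inB')
  have w2: "(\<Sum>(a,b)\<in>B. w a b * w a (b-1)) = (\<Sum>(a,b)\<in>B. w a b * w a (b+1))"
    by (subst shift[where g="\<lambda>a b. w a b * w a (b-1)" and c=0 and d=1, symmetric]) (auto simp: mult.commute dest!: w0 intro: inB')
  \<comment> \<open>Inclusion-exclusion over the two neighbours. The point and edge terms agree for
    both orientations, so only the numbers \<open>V'\<close> and \<open>V\<close> of full triangles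
    differ.\<close>
  have "(\<Sum>(a,b)\<in>B. w a b * (1 - w (a+1) b) * (1 - w a (b+1)))
      = (\<Sum>(a,b)\<in>B. w a b) - (\<Sum>(a,b)\<in>B. w a b * w (a+1) b) - (\<Sum>(a,b)\<in>B. w a b * w a (b+1)) + V'"
    unfolding V'_def sum_subtractf[symmetric] sum.distrib[symmetric]
    by (rule sum.cong) (auto simp: w_def abs_mult algebra_simps)
  moreover have "(\<Sum>(a,b)\<in>B. w a b * (1 - w (a-1) b) * (1 - w a (b-1)))
      = (\<Sum>(a,b)\<in>B. w a b) - (\<Sum>(a,b)\<in>B. w a b * w (a-1) b) - (\<Sum>(a,b)\<in>B. w a b * w a (b-1)) + V"
    unfolding V_def sum_subtractf[symmetric] sum.distrib[symmetric]
    by (rule sum.cong) (auto simp: w_def abs_mult algebra_simps)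
  ultimately have diff: "int (card (lone_high W)) - int (card (lone_low W)) = V' - V"
    unfolding high low w1 w2 by simp
  have "2 * V' \<le> (\<Sum>(a,b)\<in>B. p a b (a+1) b) + (\<Sum>(a,b)\<in>B. p a b a (b+1)) + (\<Sum>(a,b)\<in>B. p (a+1) b a (b+1))"
    unfolding V'_def sum_distrib_left sum.distrib[symmetric]
    by (rule sum_mono) (use pair_sum_ge in \<open>auto simp: p_def s_def\<close>)
  moreover have "4 * (int (card (lone_low W)) + int (card (lone_right W)) + int (card (lone_top W)))
     + ((\<Sum>(a,b)\<in>B. p a b (a-1) b) + (\<Sum>(a,b)\<in>B. p a b a (b-1)) + (\<Sum>(a,b)\<in>B. p (a-1) b a (b-1)))
     - 2 * V \<le> 4 * int (card (nodes r))"
    unfolding V_def low right right' top top' nodes sum_distrib_left sum.distrib[symmetric] sum_subtractf[symmetric]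
    apply (rule sum_mono)
    subgoal for u
      using unmixed_weight_le[of "r (fst u) (snd u)" "r (fst u - 1) (snd u)" "r (fst u) (snd u - 1)"]
      by (auto simp: p_def w_def s_def split_beta)
    done
  ultimately have "4 * (int (card (lone_low W)) + int (card (lone_right W)) + int (card (lone_top W)))
      + 2 * (V' - V) \<le> 4 * int (card (nodes r))"
    unfolding e1 e2 e3 by (simp add: algebra_simps)
  then have "int (card (lone_low W) + 2 * card (lone_right W) + 2 * card (lone_top W) + card (lone_high W))
      \<le> int (2 * card (nodes r))"
    unfolding diff[symmetric] by simp
  then show ?thesis by (simp only: of_nat_le_iff)
qed

section \<open>Boundary points of a connected planar set\<close>

text \<open>Follow the right end \<open>R b\<close> of the rows upwards. If the next row ends
  strictly further left, the end of row \<open>b\<close> is a \<open>lone_high\<close> point;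
  otherwise the end of row \<open>b + 1\<close> is a \<open>lone_right\<close> point.\<close>

lemma row_count:
  assumes fin: "finite W" and le: "b0 \<le> b1"
    and rows: "\<And>b. b0 \<le> b \<Longrightarrow> b \<le> b1 \<Longrightarrow> \<exists>a. (a, b) \<in> W"
    and below: "\<And>a. (a, b0 - 1) \<notin> W"
  shows "b1 - b0 + 1 \<le> int (card (lone_right W)) +
    int (card {(a, b) \<in> lone_high W. b < b1 \<and> (\<forall>a'>a. (a', b) \<notin> W)})"
    (is "_ \<le> _ + int (card ?X)")
proof -
  define R where "R b = Max {a. (a, b) \<in> W}" for b
  have finrow: "finite {a. (a, b) \<in> W}" for b
    by (rule finite_subset[of _ "fst ` W"]) (use fin in force)+
  have R_in: "(R b, b) \<in> W" if "b0 \<le> b" "b \<le> b1" for b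
    using Max_in[OF finrow[of b]] rows[OF that] unfolding R_def by auto
  have R_ge: "a \<le> R b" if "(a, b) \<in> W" for a b
    unfolding R_def using that finrow by (intro Max_ge) auto
  define I where "I = {b \<in> {b0..<b1}. R (b + 1) < R b}"
  define J where "J = {b \<in> {b0..<b1}. R b \<le> R (b + 1)}"
  have finIJ: "finite I" "finite J" unfolding I_def J_def by (rule finite_Collect_conjI; simp)+
  have "I \<union> J = {b0..<b1}" "I \<inter> J = {}" by (auto simp: I_def J_def)
  then have "card I + card J = card {b0..<b1}" using card_Un_disjoint[OF finIJ] by simp
  then have IJ: "int (card I) + int (card J) = b1 - b0" using le by simp
  have finL: "finite (lone_right W)" "finite ?X"
    by (rule finite_subset[OF _ fin]; force simp: lone_right_def lone_high_def)+
  have "card I \<le> card ?X"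
  proof (rule card_inj_on_le[where f = "\<lambda>b. (R b, b)"])
    show "(\<lambda>b. (R b, b)) ` I \<subseteq> ?X"
      using R_in R_ge by (fastforce simp: I_def lone_high_def)
  qed (auto simp: finL inj_on_def)
  \<comment> \<open>The bottom row counts as well, since the row under it is empty; this supplies
    the \<open>+ 1\<close> in the bound.\<close>
  moreover have "card (insert b0 ((\<lambda>b. b + 1) ` J)) \<le> card (lone_right W)"
  proof (rule card_inj_on_le[where f = "\<lambda>b. (R b, b)"])
    show "(\<lambda>b. (R b, b)) ` insert b0 ((\<lambda>b. b + 1) ` J) \<subseteq> lone_right W"
    proof (intro image_subsetI)
      fix b assume "b \<in> insert b0 ((\<lambda>b. b + 1) ` J)"
      then consider "b = b0" | c where "b = c + 1" "c \<in> J" by auto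
      then show "(R b, b) \<in> lone_right W"
      proof cases
        case 1
        then show ?thesis using R_in[of b0] R_ge[of _ b0] below le by (force simp: lone_right_def)
      next
        case 2
        then show ?thesis using R_in[of b] R_ge[of _ b] R_ge[of _ c] by (force simp: lone_right_def J_def)
      qed
    qed
  qed (auto simp: finL inj_on_def)
  moreover have "card (insert b0 ((\<lambda>b. b + 1) ` J)) = Suc (card J)"
    using finIJ by (subst card_insert_disjoint) (auto simp: J_def card_image)
  ultimately show ?thesis using IJ by linarith
qed

lemma column_count:
  assumes fin: "finite W" and le: "a0 \<le> a1"
    and cols: "\<And>a. a0 \<le> a \<Longrightarrow> a \<le> a1 \<Longrightarrow> \<exists>b. (a, b) \<in> W"
    and left: "\<And>b. (a0 - 1, b) \<notin> W"
  shows "a1 - a0 + 1 \<le> int (card (lone_top W)) +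
    int (card {(a, b) \<in> lone_high W. a < a1 \<and> (\<forall>b'>b. (a, b') \<notin> W)})"
proof -
  \<comment> \<open>Reflection in the diagonal exchanges \<open>lone_right\<close> with
    \<open>lone_top\<close> and respects \<open>lone_high\<close>.\<close>
  define V where "V = prod.swap ` W"
  have V: "(a, b) \<in> V \<longleftrightarrow> (b, a) \<in> W" for a b by (auto simp: V_def)
  have "a1 - a0 + 1 \<le> int (card (lone_right V)) +
    int (card {(a, b) \<in> lone_high V. b < a1 \<and> (\<forall>a'>a. (a', b) \<notin> V)})"
    using assms by (intro row_count) (auto simp: V, auto simp: V_def)
  also have "lone_right V = prod.swap ` lone_top W"
    by (force simp: lone_right_def lone_top_def V)
  also have "card \<dots> = card (lone_top W)" by (simp add: card_image)
  also have "{(a, b) \<in> lone_high V. b < a1 \<and> (\<forall>a'>a. (a', b) \<notin> V)}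
      = prod.swap ` {(a, b) \<in> lone_high W. a < a1 \<and> (\<forall>b'>b. (a, b') \<notin> W)}"
    by (force simp: lone_high_def V)
  also have "card \<dots> = card {(a, b) \<in> lone_high W. a < a1 \<and> (\<forall>b'>b. (a, b') \<notin> W)}"
    by (simp add: card_image)
  finally show ?thesis .
qed

text \<open>For distinct points the three inequalities leave the six neighbours \<open>e1\<close>,
  \<open>e2\<close>, \<open>e1 - e2\<close> and their negatives. Connectedness is phrased by cuts
  because it is always applied to a cut.\<close>

definition tri_connected :: "(int \<times> int) set \<Rightarrow> bool" where
  "tri_connected W \<longleftrightarrow> (\<forall>A. A \<subseteq> W \<longrightarrow> A \<noteq> {} \<longrightarrow> A \<noteq> W \<longrightarrow>
     (\<exists>a b c d. (a, b) \<in> A \<and> (c, d) \<in> W - A \<and>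
        \<bar>a - c\<bar> \<le> 1 \<and> \<bar>b - d\<bar> \<le> 1 \<and> \<bar>(a + b) - (c + d)\<bar> \<le> 1))"

lemma tri_connectedE:
  assumes "tri_connected W" and "A \<subseteq> W" and "A \<noteq> {}" and "A \<noteq> W"
  obtains a b c d where "(a, b) \<in> A" and "(c, d) \<in> W" and "(c, d) \<notin> A"
    and "\<bar>a - c\<bar> \<le> 1" and "\<bar>b - d\<bar> \<le> 1" and "\<bar>(a + b) - (c + d)\<bar> \<le> 1"
proof -
  have "\<exists>a b c d. (a, b) \<in> A \<and> (c, d) \<in> W - A \<and>
      \<bar>a - c\<bar> \<le> 1 \<and> \<bar>b - d\<bar> \<le> 1 \<and> \<bar>(a + b) - (c + d)\<bar> \<le> 1"
    using assms(1)[unfolded tri_connected_def, rule_format, OF assms(2-4)] .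
  then show thesis using that by auto
qed

text \<open>Apply \<open>row_count\<close> up to the row of \<open>(aC, bC)\<close> and
  \<open>column_count\<close> up to its column. The \<open>lone_high\<close> points used by the two
  are disjoint, and \<open>(aC, bC)\<close> is a further one: 1 + 1 + 1 makes the constant
  3.\<close>

lemma boundary_count:
  assumes fin: "finite W" and conn: "tri_connected W"
    and p: "p \<in> W" and q: "q \<in> W" and C: "(aC, bC) \<in> W"
    and pmin: "\<And>a b. (a, b) \<in> W \<Longrightarrow> fst p \<le> a"
    and qmin: "\<And>a b. (a, b) \<in> W \<Longrightarrow> snd q \<le> b"
    and Cmax: "\<And>a b. (a, b) \<in> W \<Longrightarrow> a + b \<le> aC + bC"
  shows "aC + bC - fst p - snd q + 3 \<le>
    int (card (lone_high W)) + int (card (lone_right W)) + int (card (lone_top W))"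
proof -
  have rows: "\<exists>a. (a, b) \<in> W" if "snd q \<le> b" "b \<le> bC" for b
  proof (rule ccontr)
    assume none: "\<nexists>a. (a, b) \<in> W"
    \<comment> \<open>An edge changes the height by at most 1, so an edge leaving the part below
      \<open>b\<close> must end in row \<open>b\<close>.\<close>
    let ?A = "{u \<in> W. snd u < b}"
    have "q \<in> ?A" using q none that by (metis (mono_tags, lifting) mem_Collect_eq order_le_less prod.collapse)
    moreover have "(aC, bC) \<notin> ?A" using that by auto
    ultimately have "?A \<subseteq> W" "?A \<noteq> {}" "?A \<noteq> W" using C by blast+
    from conn this obtain x y c d where "(x, y) \<in> ?A" "(c, d) \<in> W" "(c, d) \<notin> ?A"
      "\<bar>x - c\<bar> \<le> 1" "\<bar>y - d\<bar> \<le> 1" by (rule tri_connectedE)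
    then have "y < b" "(c, d) \<in> W" "\<not> d < b" "\<bar>y - d\<bar> \<le> 1" by auto
    then have "d = b" by linarith
    then show False using none \<open>(c, d) \<in> W\<close> by blast
  qed
  have cols: "\<exists>b. (a, b) \<in> W" if "fst p \<le> a" "a \<le> aC" for a
  proof (rule ccontr)
    assume none: "\<nexists>b. (a, b) \<in> W"
    let ?A = "{u \<in> W. fst u < a}"
    have "p \<in> ?A" using p none that by (metis (mono_tags, lifting) mem_Collect_eq order_le_less prod.collapse)
    moreover have "(aC, bC) \<notin> ?A" using that by auto
    ultimately have "?A \<subseteq> W" "?A \<noteq> {}" "?A \<noteq> W" using C by blast+
    from conn this obtain x y c d where "(x, y) \<in> ?A" "(c, d) \<in> W" "(c, d) \<notin> ?A"
      "\<bar>x - c\<bar> \<le> 1" "\<bar>y - d\<bar> \<le> 1" by (rule tri_connectedE)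
    then have "x < a" "(c, d) \<in> W" "\<not> c < a" "\<bar>x - c\<bar> \<le> 1" by auto
    then have "c = a" by linarith
    then show False using none \<open>(c, d) \<in> W\<close> by blast
  qed
  let ?X = "{(a, b) \<in> lone_high W. b < bC \<and> (\<forall>a'>a. (a', b) \<notin> W)}"
  let ?Y = "{(a, b) \<in> lone_high W. a < aC \<and> (\<forall>b'>b. (a, b') \<notin> W)}"
  have finM: "finite (lone_high W)" by (rule finite_subset[OF _ fin]) (auto simp: lone_high_def)
  have X: "bC - snd q + 1 \<le> int (card (lone_right W)) + int (card ?X)"
    using qmin[of _ "snd q - 1"] qmin[OF C] rows by (intro row_count[OF fin]) auto
  have Y: "aC - fst p + 1 \<le> int (card (lone_top W)) + int (card ?Y)"
    using pmin[of "fst p - 1"] pmin[OF C] cols by (intro column_count[OF fin]) auto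
  \<comment> \<open>A point of both sets would be the corner of an empty L, which separates it from the maximiser of \<open>a + b\<close>.\<close>
  have disj: "?X \<inter> ?Y = {}"
  proof (rule ccontr)
    assume "?X \<inter> ?Y \<noteq> {}"
    then obtain a b where ab: "(a, b) \<in> W" "a < aC" "b < bC"
      and L: "\<And>a'. a' > a \<Longrightarrow> (a', b) \<notin> W" "\<And>b'. b' > b \<Longrightarrow> (a, b') \<notin> W"
      by (auto simp: lone_high_def)
    let ?A = "{u \<in> W. a < fst u \<and> b < snd u}"
    have "(aC, bC) \<in> ?A" "(a, b) \<notin> ?A" using ab C by auto
    then have "?A \<subseteq> W" "?A \<noteq> {}" "?A \<noteq> W" using ab(1) by blast+
    from conn this obtain x y c d where xycd: "(x, y) \<in> ?A" "(c, d) \<in> W" "(c, d) \<notin> ?A"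
      "\<bar>x - c\<bar> \<le> 1" "\<bar>y - d\<bar> \<le> 1" "\<bar>(x + y) - (c + d)\<bar> \<le> 1" by (rule tri_connectedE)
    then have "a < x" "b < y" "c \<le> a \<or> d \<le> b" by (auto simp: not_less)
    then have "c = a \<and> d > b \<or> d = b \<and> c > a" using xycd(4-6) by linarith
    then show False using L \<open>(c, d) \<in> W\<close> by auto
  qed
  \<comment> \<open>The strict bounds \<open>b < bC\<close> and \<open>a < aC\<close> keep
    \<open>(aC, bC)\<close> out of both sets.\<close>
  have "(aC + 1, bC) \<notin> W" "(aC, bC + 1) \<notin> W"
    using Cmax by force+
  then have "insert (aC, bC) (?X \<union> ?Y) \<subseteq> lone_high W" using C by (auto simp: lone_high_def)
  then have "card (insert (aC, bC) (?X \<union> ?Y)) \<le> card (lone_high W)" by (rule card_mono[OF finM])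
  moreover have "finite ?X" "finite ?Y" by (rule finite_subset[OF _ finM]; auto)+
  then have "card (insert (aC, bC) (?X \<union> ?Y)) = Suc (card ?X + card ?Y)"
    using disj by (subst card_insert_disjoint) (auto simp: card_Un_disjoint)
  ultimately show ?thesis using X Y by linarith
qed

text \<open>The weights in \<open>nodes_lower_bound\<close> exceed those in
  \<open>boundary_count\<close> by one \<open>lone_low\<close>, one \<open>lone_right\<close> and
  one \<open>lone_top\<close>. Each kind occurs at an extreme point of \<open>W\<close>, which
  raises the constant from 3 to 6.\<close>

lemma nodes_extent:
  fixes r :: "int \<Rightarrow> int \<Rightarrow> real"
  defines "W \<equiv> {(a, b). r a b \<noteq> 0}"
  assumes fin: "finite W" and conn: "tri_connected W" and "p \<in> W" and "q \<in> W" and "c \<in> W"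
  shows "fst c + snd c - fst p - snd q + 6 \<le> 2 * int (card (nodes r))"
proof -
  have ex: "\<exists>u\<in>W. \<forall>v\<in>W. f u \<le> f v" for f :: "int \<times> int \<Rightarrow> int"
    using ex_min_if_finite[of "f ` W"] fin \<open>p \<in> W\<close> by (auto simp: not_less)
  obtain p' where p': "p' \<in> W" "\<And>v. v \<in> W \<Longrightarrow> fst p' \<le> fst v" using ex[of fst] by blast
  obtain q' where q': "q' \<in> W" "\<And>v. v \<in> W \<Longrightarrow> snd q' \<le> snd v" using ex[of snd] by blast
  obtain c' where c': "c' \<in> W" "\<And>v. v \<in> W \<Longrightarrow> fst v + snd v \<le> fst c' + snd c'"
    using ex[of "\<lambda>v. - (fst v + snd v)"] by force
  obtain x where x: "x \<in> W" "\<And>v. v \<in> W \<Longrightarrow> fst v \<le> fst x"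
    using ex[of "\<lambda>v. - fst v"] by force
  obtain y where y: "y \<in> W" "\<And>v. v \<in> W \<Longrightarrow> snd v \<le> snd y"
    using ex[of "\<lambda>v. - snd v"] by force
  obtain z where z: "z \<in> W" "\<And>v. v \<in> W \<Longrightarrow> fst z + snd z \<le> fst v + snd v"
    using ex[of "\<lambda>v. fst v + snd v"] by blast
  have "x \<in> lone_right W" using x by (force simp: lone_right_def)
  moreover have "y \<in> lone_top W" using y by (force simp: lone_top_def)
  moreover have "z \<in> lone_low W" using z by (force simp: lone_low_def)
  moreover have "finite (lone_right W)" "finite (lone_top W)" "finite (lone_low W)"
    by (rule finite_subset[OF _ fin]; auto simp: lone_right_def lone_top_def lone_low_def)+
  ultimately have "card (lone_right W) > 0" "card (lone_top W) > 0" "card (lone_low W) > 0"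
    by (auto simp: card_gt_0_iff)
  moreover have "fst c' + snd c' - fst p' - snd q' + 3 \<le>
      int (card (lone_high W)) + int (card (lone_right W)) + int (card (lone_top W))"
    using p' q' c' by (intro boundary_count[OF fin conn]) force+
  moreover have "card (lone_low W) + 2 * card (lone_right W) + 2 * card (lone_top W) + card (lone_high W)
    \<le> 2 * card (nodes r)"
    using nodes_lower_bound[of r] fin unfolding W_def .
  ultimately show ?thesis using p'(2)[OF \<open>p \<in> W\<close>] q'(2)[OF \<open>q \<in> W\<close>] c'(2)[OF \<open>c \<in> W\<close>] by linarith
qed

section \<open>Generic points\<close>

lemma digits_unique:
  fixes \<alpha> \<beta> :: "nat \<Rightarrow> nat"
  assumes "\<And>k. k < m \<Longrightarrow> \<alpha> k < M" and "\<And>k. k < m \<Longrightarrow> \<beta> k < M"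
    and "(\<Sum>k<m. \<alpha> k * M ^ k) = (\<Sum>k<m. \<beta> k * M ^ k)" and "k < m"
  shows "\<alpha> k = \<beta> k"
  using assms
proof (induction m arbitrary: \<alpha> \<beta> k)
  case (Suc m)
  have split: "(\<Sum>k<Suc m. \<gamma> k * M ^ k) = \<gamma> 0 + M * (\<Sum>k<m. \<gamma> (Suc k) * M ^ k)" for \<gamma> :: "nat \<Rightarrow> nat"
    by (simp only: sum.lessThan_Suc_shift sum_distrib_left) (simp add: algebra_simps)
  have less: "\<alpha> 0 < M" "\<beta> 0 < M" using Suc.prems by auto
  have eq: "\<alpha> 0 + M * (\<Sum>k<m. \<alpha> (Suc k) * M ^ k) = \<beta> 0 + M * (\<Sum>k<m. \<beta> (Suc k) * M ^ k)"
    using Suc.prems(3) unfolding split .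
  then have "\<alpha> 0 = \<beta> 0" using less by (metis mod_less mod_mult_self2)
  moreover from this eq less have "(\<Sum>k<m. \<alpha> (Suc k) * M ^ k) = (\<Sum>k<m. \<beta> (Suc k) * M ^ k)"
    by simp
  then have "\<alpha> (Suc l) = \<beta> (Suc l)" if "l < m" for l
    using Suc.IH[of "\<lambda>k. \<alpha> (Suc k)" "\<lambda>k. \<beta> (Suc k)" l] Suc.prems(1,2) that by auto
  ultimately show ?case using Suc.prems(4) by (cases k) auto
qed simp

text \<open>Substituting \<open>x k = t ^ M ^ k\<close> for large \<open>M\<close> keeps distinct monomials distinct.\<close>

lemma nonvanishing_substitution:
  assumes "is_poly n g" and "g \<noteq> (\<lambda>_. 0)"
    and M: "\<And>\<alpha> k. \<alpha> \<in> supp g \<Longrightarrow> \<alpha> k < M"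
  shows "finite {t. peval n g (\<lambda>k. t ^ M ^ k) = 0}"
proof -
  define e where "e \<alpha> = (\<Sum>k<Suc n. \<alpha> k * M ^ k)" for \<alpha> :: "nat \<Rightarrow> nat"
  define p where "p = (\<Sum>\<alpha>\<in>supp g. monom (g \<alpha>) (e \<alpha>))"
  have fin: "finite (supp g)" using assms(1) by (simp add: is_poly_def)
  have inj: "\<alpha> = \<beta>" if "\<alpha> \<in> supp g" "\<beta> \<in> supp g" "e \<alpha> = e \<beta>" for \<alpha> \<beta>
  proof
    fix k
    show "\<alpha> k = \<beta> k"
    proof (cases "k < Suc n")
      case True
      show ?thesis
        by (rule digits_unique[of "Suc n" \<alpha> M \<beta>]) (use that M True in \<open>auto simp: e_def\<close>)
    next
      case False
      then have "k > n" by simp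
      then show ?thesis using that assms(1) unfolding is_poly_def by metis
    qed
  qed
  obtain \<beta> where \<beta>: "g \<beta> \<noteq> 0" using assms(2) by blast
  \<comment> \<open>No other monomial is sent to the exponent \<open>e \<beta>\<close>, so no
    cancellation can occur there.\<close>
  have "coeff p (e \<beta>) = (\<Sum>\<alpha>\<in>supp g. if \<alpha> = \<beta> then g \<alpha> else 0)"
    unfolding p_def coeff_sum using inj \<beta> by (intro sum.cong) (auto simp: supp_def)
  also have "\<dots> = g \<beta>" using fin \<beta> by (simp add: supp_def)
  finally have "p \<noteq> 0" using \<beta> by auto
  moreover have "poly p t = peval n g (\<lambda>k. t ^ M ^ k)" for t
    by (simp add: p_def peval_def poly_sum poly_monom e_def power_sum power_mult[symmetric] mult.commute lessThan_Suc_atMost)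
  ultimately show ?thesis using poly_roots_finite[of p] by simp
qed

text \<open>With \<open>M\<close> above all exponents occurring in \<open>G\<close>, each member
  excludes only finitely many \<open>t\<close>, and the positive half-line is infinite. Positivity
  of \<open>x\<close> later makes the weights in the planar recursion positive.\<close>

lemma generic_positive_point:
  assumes "finite G" and G: "\<And>g. g \<in> G \<Longrightarrow> is_poly n g" "\<And>g. g \<in> G \<Longrightarrow> g \<noteq> (\<lambda>_. 0)"
  obtains x where "\<And>k. x k > 0" and "\<And>g. g \<in> G \<Longrightarrow> peval n g x \<noteq> 0"
proof -
  let ?E = "insert 0 ((\<lambda>(\<alpha>, k). \<alpha> k) ` ((\<Union>g\<in>G. supp g) \<times> {..n}))"
  define M where "M = Suc (Max ?E)"
  have fin: "finite ?E" using assms by (auto simp: is_poly_def)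
  have M: "\<alpha> k < M" if "g \<in> G" "\<alpha> \<in> supp g" for g \<alpha> k
  proof (cases "k \<le> n")
    case True
    then have "\<alpha> k \<in> ?E" using that by force
    then show ?thesis unfolding M_def using Max_ge[OF fin] by (simp only: less_Suc_eq_le)
  next
    case False
    then have "\<alpha> k = 0" using that G(1) unfolding is_poly_def by (meson not_le)
    then show ?thesis by (simp add: M_def)
  qed
  have "finite (\<Union>g\<in>G. {t. peval n g (\<lambda>k. t ^ M ^ k) = 0})"
    using assms M by (intro finite_UN_I nonvanishing_substitution) auto
  moreover have "infinite {0::real<..}" by (rule infinite_Ioi)
  ultimately have "\<not> {0<..} \<subseteq> (\<Union>g\<in>G. {t. peval n g (\<lambda>k. t ^ M ^ k) = 0})"
    using finite_subset by blast
  then obtain t where "t > 0" "\<And>g. g \<in> G \<Longrightarrow> peval n g (\<lambda>k. t ^ M ^ k) \<noteq> 0" by auto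
  then show thesis by (intro that[of "\<lambda>k. t ^ M ^ k"]) auto
qed

section \<open>Multiplication and division by the sum of the variables\<close>

definition exps :: "nat \<Rightarrow> nat \<Rightarrow> (nat \<Rightarrow> nat) set" where
  "exps n d = {\<alpha>. tdeg n \<alpha> = d \<and> (\<forall>i>n. \<alpha> i = 0)}"

lemma finite_exps: "finite (exps n d)"
proof (rule finite_subset)
  show "exps n d \<subseteq> {f. \<forall>i. (i \<in> {..n} \<longrightarrow> f i \<in> {..d}) \<and> (i \<notin> {..n} \<longrightarrow> f i = 0)}"
    using member_le_sum[of _ "{..n}"] by (auto simp: exps_def tdeg_def)
qed (rule finite_set_of_finite_funs; simp)

lemma tdeg_fun_upd: "k \<le> n \<Longrightarrow> tdeg n (\<alpha>(k := m)) + \<alpha> k = tdeg n \<alpha> + m"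
  unfolding tdeg_def by (subst (1 2) sum.remove[of "{..n}" k]) auto

lemma fun_upd_Suc_in_exps: "\<alpha> \<in> exps n d \<Longrightarrow> k \<le> n \<Longrightarrow> \<alpha>(k := Suc (\<alpha> k)) \<in> exps n (Suc d)"
  using tdeg_fun_upd[of k n \<alpha> "Suc (\<alpha> k)"] by (auto simp: exps_def)

lemma fun_upd_pred_in_exps:
  "\<beta> \<in> exps n (Suc d) \<Longrightarrow> k \<le> n \<Longrightarrow> \<beta> k > 0 \<Longrightarrow> \<beta>(k := \<beta> k - 1) \<in> exps n d"
  using tdeg_fun_upd[of k n \<beta> "\<beta> k - 1"] by (auto simp: exps_def)

lemma peval_eq_sum_exps:
  assumes "supp F \<subseteq> exps n d"
  shows "peval n F x = (\<Sum>\<alpha>\<in>exps n d. F \<alpha> * (\<Prod>i\<le>n. x i ^ \<alpha> i))"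
  unfolding peval_def using assms by (intro sum.mono_neutral_left finite_exps) (auto simp: supp_def)

lemma is_poly_if_supp_exps: "supp F \<subseteq> exps n d \<Longrightarrow> is_poly n F"
  unfolding is_poly_def using finite_subset[OF _ finite_exps] by (auto simp: exps_def)

text \<open>The coefficients of \<open>S Q\<close>. The guard discards the terms in which truncated
  subtraction would leave the exponent unchanged.\<close>

definition mulS :: "nat \<Rightarrow> ((nat \<Rightarrow> nat) \<Rightarrow> real) \<Rightarrow> (nat \<Rightarrow> nat) \<Rightarrow> real" where
  "mulS n Q \<beta> = (\<Sum>k\<le>n. if \<beta> k > 0 then Q (\<beta>(k := \<beta> k - 1)) else 0)"

lemma supp_mulSE:
  assumes "\<beta> \<in> supp (mulS n Q)"
  obtains \<alpha> k where "\<alpha> \<in> supp Q" and "k \<le> n" and "\<beta> = \<alpha>(k := Suc (\<alpha> k))"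
proof -
  have "(\<Sum>k\<le>n. if \<beta> k > 0 then Q (\<beta>(k := \<beta> k - 1)) else 0) \<noteq> 0"
    using assms by (simp add: mulS_def supp_def)
  then obtain k where "k \<le> n" "\<beta> k > 0" "Q (\<beta>(k := \<beta> k - 1)) \<noteq> 0"
    by (elim sum.not_neutral_contains_not_neutral) (auto split: if_splits)
  then show thesis by (intro that[of "\<beta>(k := \<beta> k - 1)" k]) (auto simp: supp_def)
qed

lemma supp_mulS: "supp Q \<subseteq> exps n d \<Longrightarrow> supp (mulS n Q) \<subseteq> exps n (Suc d)"
  using fun_upd_Suc_in_exps by (fastforce elim: supp_mulSE)

text \<open>Multiplication by \<open>S\<close> is transposed onto the test function. Monomial values
  as \<open>\<phi>\<close> give the evaluation rule; values restricted to one fibre of a projection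
  give the planar recursion.\<close>

lemma sum_mulS:
  "(\<Sum>\<beta>\<in>exps n (Suc d). mulS n Q \<beta> * \<phi> \<beta>)
    = (\<Sum>\<alpha>\<in>exps n d. Q \<alpha> * (\<Sum>k\<le>n. \<phi> (\<alpha>(k := Suc (\<alpha> k)))))"
proof -
  have "(\<Sum>\<beta>\<in>exps n (Suc d). mulS n Q \<beta> * \<phi> \<beta>)
      = (\<Sum>k\<le>n. \<Sum>\<beta>\<in>exps n (Suc d). if \<beta> k > 0 then Q (\<beta>(k := \<beta> k - 1)) * \<phi> \<beta> else 0)"
    unfolding mulS_def sum_distrib_right by (subst sum.swap) (auto intro!: sum.cong)
  also have "\<dots> = (\<Sum>k\<le>n. \<Sum>\<alpha>\<in>exps n d. Q \<alpha> * \<phi> (\<alpha>(k := Suc (\<alpha> k))))"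
  proof (rule sum.cong[OF refl])
    fix k assume "k \<in> {..n}"
    then have k: "k \<le> n" by simp
    have "(\<Sum>\<beta>\<in>exps n (Suc d). if \<beta> k > 0 then Q (\<beta>(k := \<beta> k - 1)) * \<phi> \<beta> else 0)
        = (\<Sum>\<beta> | \<beta> \<in> exps n (Suc d) \<and> \<beta> k > 0. Q (\<beta>(k := \<beta> k - 1)) * \<phi> \<beta>)"
      by (rule sum.inter_filter[OF finite_exps, symmetric])
    also have "\<dots> = (\<Sum>\<alpha>\<in>exps n d. Q \<alpha> * \<phi> (\<alpha>(k := Suc (\<alpha> k))))"
      by (rule sum.reindex_bij_witness[of _ "\<lambda>\<alpha>. \<alpha>(k := Suc (\<alpha> k))" "\<lambda>\<beta>. \<beta>(k := \<beta> k - 1)"])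
         (auto simp: fun_upd_pred_in_exps[simplified] fun_upd_Suc_in_exps k)
    finally show "(\<Sum>\<beta>\<in>exps n (Suc d). if \<beta> k > 0 then Q (\<beta>(k := \<beta> k - 1)) * \<phi> \<beta> else 0)
        = (\<Sum>\<alpha>\<in>exps n d. Q \<alpha> * \<phi> (\<alpha>(k := Suc (\<alpha> k))))" .
  qed
  also have "\<dots> = (\<Sum>\<alpha>\<in>exps n d. Q \<alpha> * (\<Sum>k\<le>n. \<phi> (\<alpha>(k := Suc (\<alpha> k)))))"
    by (subst sum.swap) (simp add: sum_distrib_left)
  finally show ?thesis .
qed

lemma prod_power_fun_upd_Suc:
  "k \<le> n \<Longrightarrow> (\<Prod>i\<le>n. x i ^ (\<alpha>(k := Suc (\<alpha> k))) i) = x k * (\<Prod>i\<le>n. x i ^ \<alpha> i)"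
  for x :: "nat \<Rightarrow> real"
  by (subst (1 2) prod.remove[of "{..n}" k]) (auto intro!: prod.cong)

lemma peval_mulS:
  assumes "supp Q \<subseteq> exps n d"
  shows "peval n (mulS n Q) x = (\<Sum>i\<le>n. x i) * peval n Q x"
proof -
  have "peval n (mulS n Q) x
      = (\<Sum>\<alpha>\<in>exps n d. Q \<alpha> * (\<Sum>k\<le>n. (\<Prod>i\<le>n. x i ^ (\<alpha>(k := Suc (\<alpha> k))) i)))"
    by (subst peval_eq_sum_exps[OF supp_mulS[OF assms]]) (rule sum_mulS)
  also have "\<dots> = (\<Sum>\<alpha>\<in>exps n d. Q \<alpha> * (\<Sum>k\<le>n. x k * (\<Prod>i\<le>n. x i ^ \<alpha> i)))"
    by (intro sum.cong arg_cong2[where f = "(*)"] refl prod_power_fun_upd_Suc) simp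
  also have "\<dots> = (\<Sum>i\<le>n. x i) * peval n Q x"
    by (simp add: peval_eq_sum_exps[OF assms] sum_distrib_left sum_distrib_right[symmetric] mult.left_commute)
  finally show ?thesis .
qed

lemma in_I_mulS: "supp Q \<subseteq> exps n d \<Longrightarrow> in_I n (mulS n Q)"
  unfolding in_I_def homogeneous_def
  using is_poly_if_supp_exps[OF supp_mulS, of Q n d] supp_mulS[of Q n d] peval_mulS[of Q n d]
  by (auto simp: exps_def)

text \<open>Take \<open>\<alpha>\<close> in the support with the largest exponent of
  \<open>X_0\<close>. Only \<open>\<alpha>\<close> contributes to the coefficient of
  \<open>X_0 X^\<alpha>\<close>, so this coefficient is \<open>Q \<alpha>\<close>.\<close>

lemma mulS_nonzero:
  assumes "supp Q \<subseteq> exps n d" and "supp Q \<noteq> {}"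
  shows "mulS n Q \<noteq> (\<lambda>_. 0)"
proof -
  have fin: "finite (supp Q)" using assms(1) finite_exps by (rule finite_subset)
  then have "Max ((\<lambda>\<alpha>. \<alpha> 0) ` supp Q) \<in> (\<lambda>\<alpha>. \<alpha> 0) ` supp Q" using assms(2) by (intro Max_in) auto
  then obtain \<alpha> where \<alpha>: "\<alpha> \<in> supp Q" and "\<alpha> 0 = Max ((\<lambda>\<alpha>. \<alpha> 0) ` supp Q)" by (metis imageE)
  then have max: "\<beta> 0 \<le> \<alpha> 0" if "\<beta> \<in> supp Q" for \<beta> using fin that by simp
  let ?\<beta> = "\<alpha>(0 := Suc (\<alpha> 0))"
  have "Q (?\<beta>(k := ?\<beta> k - 1)) = 0" if "k \<noteq> 0" for k
    using max[of "?\<beta>(k := ?\<beta> k - 1)"] that by (auto simp: supp_def)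
  then have "mulS n Q ?\<beta> = (\<Sum>k\<le>n. if k = 0 then Q \<alpha> else 0)"
    unfolding mulS_def by (intro sum.cong) auto
  also have "\<dots> = Q \<alpha>" by simp
  finally show ?thesis using \<alpha> unfolding supp_def by (metis mem_Collect_eq)
qed

text \<open>The quotient on division by \<open>S\<close>, regarded as a monic linear polynomial in \<open>X\<^sub>0\<close>.\<close>

function quo :: "nat \<Rightarrow> ((nat \<Rightarrow> nat) \<Rightarrow> real) \<Rightarrow> (nat \<Rightarrow> nat) \<Rightarrow> real" where
  "quo n P \<alpha> = P (\<alpha>(0 := Suc (\<alpha> 0))) -
     (\<Sum>k\<in>{1..n}. if \<alpha> k > 0 then quo n P (\<alpha>(0 := Suc (\<alpha> 0), k := \<alpha> k - 1)) else 0)"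
  by pat_completeness auto
termination
proof (relation "measure (\<lambda>(n, P, \<alpha>). \<Sum>i\<in>{1..n}. \<alpha> i)")
  fix n k and P :: "(nat \<Rightarrow> nat) \<Rightarrow> real" and \<alpha> :: "nat \<Rightarrow> nat"
  assume "k \<in> {1..n}" "\<alpha> k > 0"
  then have "(\<Sum>i\<in>{1..n}. (\<alpha>(0 := Suc (\<alpha> 0), k := \<alpha> k - 1)) i) < (\<Sum>i\<in>{1..n}. \<alpha> i)"
    by (intro sum_strict_mono_ex1) auto
  then show "((n, P, \<alpha>(0 := Suc (\<alpha> 0), k := \<alpha> k - 1)), (n, P, \<alpha>)) \<in> measure (\<lambda>(n, P, \<alpha>). \<Sum>i\<in>{1..n}. \<alpha> i)"
    by simp
qed simp

declare quo.simps [simp del]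

lemma quo_nonzero_in_exps:
  assumes "supp P \<subseteq> exps n (Suc d)"
  shows "quo n P \<alpha> \<noteq> 0 \<Longrightarrow> \<alpha> \<in> exps n d"
proof (induction "\<Sum>i\<in>{1..n}. \<alpha> i" arbitrary: \<alpha> rule: less_induct)
  case less
  show ?case
  proof (cases "P (\<alpha>(0 := Suc (\<alpha> 0))) = 0")
    case False
    then have "\<alpha>(0 := Suc (\<alpha> 0)) \<in> exps n (Suc d)" using assms by (auto simp: supp_def)
    then show ?thesis using fun_upd_pred_in_exps[of "\<alpha>(0 := Suc (\<alpha> 0))" n d 0] by simp
  next
    case True
    then have "(\<Sum>k\<in>{1..n}. if \<alpha> k > 0 then quo n P (\<alpha>(0 := Suc (\<alpha> 0), k := \<alpha> k - 1)) else 0) \<noteq> 0"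
      using less.prems by (simp add: quo.simps[of n P \<alpha>])
    then obtain k where k: "k \<in> {1..n}" "\<alpha> k > 0"
      "quo n P (\<alpha>(0 := Suc (\<alpha> 0), k := \<alpha> k - 1)) \<noteq> 0"
      by (elim sum.not_neutral_contains_not_neutral) (auto split: if_splits)
    have "(\<Sum>i\<in>{1..n}. (\<alpha>(0 := Suc (\<alpha> 0), k := \<alpha> k - 1)) i) < (\<Sum>i\<in>{1..n}. \<alpha> i)"
      using k by (intro sum_strict_mono_ex1) auto
    then have "\<alpha>(0 := Suc (\<alpha> 0), k := \<alpha> k - 1) \<in> exps n d" using k(3) by (rule less.hyps)
    moreover have "tdeg n (\<alpha>(0 := Suc (\<alpha> 0), k := \<alpha> k - 1)) = tdeg n \<alpha>"
      using tdeg_fun_upd[of 0 n \<alpha> "Suc (\<alpha> 0)"] k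
        tdeg_fun_upd[of k n "\<alpha>(0 := Suc (\<alpha> 0))" "\<alpha> k - 1"] by auto
    ultimately show ?thesis using k(1) by (auto simp: exps_def split: if_splits)
  qed
qed

text \<open>The recursion for \<open>quo\<close> is the coefficient equation of
  \<open>S Q = P\<close> solved for its term \<open>k = 0\<close>. Exponents with
  \<open>\<beta> 0 = 0\<close> are left to the remainder.\<close>

lemma quo_spec:
  assumes "\<beta> 0 > 0"
  shows "mulS n (quo n P) \<beta> = P \<beta>"
proof -
  let ?\<alpha> = "\<beta>(0 := \<beta> 0 - 1)"
  have "mulS n (quo n P) \<beta> = quo n P ?\<alpha> + (\<Sum>k\<in>{1..n}. if \<beta> k > 0 then quo n P (\<beta>(k := \<beta> k - 1)) else 0)"
    unfolding mulS_def using assms by (subst sum.remove[of "{..n}" 0]) (auto intro!: sum.cong)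
  moreover have "(\<Sum>k\<in>{1..n}. if ?\<alpha> k > 0 then quo n P (?\<alpha>(0 := Suc (?\<alpha> 0), k := ?\<alpha> k - 1)) else 0)
      = (\<Sum>k\<in>{1..n}. if \<beta> k > 0 then quo n P (\<beta>(k := \<beta> k - 1)) else 0)"
    using assms by (intro sum.cong) auto
  ultimately show ?thesis using assms quo.simps[of n P ?\<alpha>] by simp
qed

text \<open>The remainder does not involve \<open>X_0\<close> and vanishes on the hyperplane
  \<open>S = 0\<close>. Since \<open>X_0\<close> can be chosen to reach that hyperplane from any
  values of the other variables, the remainder vanishes everywhere.\<close>

lemma in_I_factor:
  assumes "in_I n P" and PE: "supp P \<subseteq> exps n (Suc d)"
  obtains Q where "supp Q \<subseteq> exps n d" and "P = mulS n Q"
proof -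
  define Q where "Q = quo n P"
  define R where "R = (\<lambda>\<beta>. P \<beta> - mulS n Q \<beta>)"
  have Q: "supp Q \<subseteq> exps n d" using quo_nonzero_in_exps[OF PE] by (auto simp: Q_def supp_def)
  have R: "supp R \<subseteq> exps n (Suc d)" using PE supp_mulS[OF Q] by (force simp: R_def supp_def)
  have R0: "\<beta> 0 = 0" if "\<beta> \<in> supp R" for \<beta>
    using quo_spec[of \<beta> n P] that by (cases "\<beta> 0") (auto simp: R_def supp_def Q_def)
  have "R = (\<lambda>_. 0)"
  proof (rule ccontr)
    assume "R \<noteq> (\<lambda>_. 0)"
    then obtain x where x: "peval n R x \<noteq> 0"
      using generic_positive_point[of "{R}" n] is_poly_if_supp_exps[OF R] by (metis finite.emptyI finite.insertI singletonD singletonI)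
    define y where "y = x(0 := - (\<Sum>i\<in>{1..n}. x i))"
    have "(\<Sum>i\<le>n. y i) = y 0 + (\<Sum>i\<in>{1..n}. y i)"
      by (subst sum.remove[of "{..n}" 0]) (auto intro!: sum.cong)
    also have "(\<Sum>i\<in>{1..n}. y i) = (\<Sum>i\<in>{1..n}. x i)" by (rule sum.cong) (auto simp: y_def)
    finally have y: "(\<Sum>i\<le>n. y i) = 0" by (simp add: y_def)
    have "peval n R x = peval n R y"
      unfolding peval_def by (intro sum.cong arg_cong2[where f = "(*)"] prod.cong refl) (auto simp: y_def R0)
    also have "\<dots> = peval n P y - peval n (mulS n Q) y"
      unfolding peval_eq_sum_exps[OF R] peval_eq_sum_exps[OF PE] peval_eq_sum_exps[OF supp_mulS[OF Q]]
      by (simp add: R_def left_diff_distrib sum_subtractf)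
    also have "\<dots> = 0" using assms(1) y peval_mulS[OF Q, of y] by (simp add: in_I_def)
    finally show False using x by simp
  qed
  then have "P = mulS n Q" by (auto simp: R_def fun_eq_iff)
  then show thesis using Q that by blast
qed

section \<open>Projection to two exponents\<close>

text \<open>Two exponents are adjacent when their monomials, each multiplied by some variable, can
  meet in one monomial of \<open>S Q\<close>.\<close>

definition exp_connected :: "nat \<Rightarrow> (nat \<Rightarrow> nat) set \<Rightarrow> bool" where
  "exp_connected n X \<longleftrightarrow> (\<forall>A. A \<subseteq> X \<longrightarrow> A \<noteq> {} \<longrightarrow> A \<noteq> X \<longrightarrow>
     (\<exists>\<alpha>\<in>A. \<exists>\<beta>\<in>X - A. \<exists>k\<le>n. \<exists>l\<le>n. \<alpha>(k := Suc (\<alpha> k)) = \<beta>(l := Suc (\<beta> l))))"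

text \<open>A cut of the support splits \<open>Q\<close> into \<open>F + G\<close>. Then
  \<open>S F\<close> and \<open>S G\<close> are nonzero members of the ideal adding up to
  \<open>S Q\<close>, so by indecomposability they share a monomial, which yields an edge across the
  cut.\<close>

lemma indecomposable_imp_exp_connected:
  assumes ind: "indecomposable n (mulS n Q)" and Q: "supp Q \<subseteq> exps n d"
  shows "exp_connected n (supp Q)"
  unfolding exp_connected_def
proof (intro allI impI)
  fix A assume A: "A \<subseteq> supp Q" "A \<noteq> {}" "A \<noteq> supp Q"
  define F where "F = (\<lambda>\<alpha>. if \<alpha> \<in> A then Q \<alpha> else 0)"
  define G where "G = (\<lambda>\<alpha>. if \<alpha> \<in> A then 0 else Q \<alpha>)"
  have F: "supp F = A" using A(1) by (auto simp: F_def supp_def)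
  have G: "supp G = supp Q - A" by (auto simp: G_def supp_def)
  have FE: "supp F \<subseteq> exps n d" and GE: "supp G \<subseteq> exps n d" using F G A(1) Q by blast+
  have "supp F \<noteq> {}" "supp G \<noteq> {}" using F G A by blast+
  then have "in_I n (mulS n F)" "in_I n (mulS n G)" "mulS n F \<noteq> (\<lambda>_. 0)" "mulS n G \<noteq> (\<lambda>_. 0)"
    using in_I_mulS[OF FE] in_I_mulS[OF GE] mulS_nonzero[OF FE] mulS_nonzero[OF GE] by simp_all
  moreover have "mulS n Q = (\<lambda>\<alpha>. mulS n F \<alpha> + mulS n G \<alpha>)"
    unfolding mulS_def F_def G_def sum.distrib[symmetric] by (intro ext sum.cong) auto
  ultimately have "supp (mulS n F) \<inter> supp (mulS n G) \<noteq> {}"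
    using ind unfolding indecomposable_def by blast
  then obtain \<gamma> where "\<gamma> \<in> supp (mulS n F)" "\<gamma> \<in> supp (mulS n G)" by blast
  then obtain \<alpha> k \<beta> l where "\<alpha> \<in> supp F" "k \<le> n" "\<gamma> = \<alpha>(k := Suc (\<alpha> k))"
    "\<beta> \<in> supp G" "l \<le> n" "\<gamma> = \<beta>(l := Suc (\<beta> l))"
    by (elim supp_mulSE) blast
  then show "\<exists>\<alpha>\<in>A. \<exists>\<beta>\<in>supp Q - A. \<exists>k\<le>n. \<exists>l\<le>n. \<alpha>(k := Suc (\<alpha> k)) = \<beta>(l := Suc (\<beta> l))"
    using F G by metis
qed

text \<open>A cut of the image pulls back to a cut of \<open>X\<close>; the edge across it projects
  to a lattice edge.\<close>

lemma tri_connected_projection: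
  assumes conn: "exp_connected n X" and "i \<noteq> j"
  shows "tri_connected ((\<lambda>\<alpha>. (int (\<alpha> i), int (\<alpha> j))) ` X)"
  unfolding tri_connected_def
proof (intro allI impI)
  let ?\<pi> = "\<lambda>\<alpha> :: nat \<Rightarrow> nat. (int (\<alpha> i), int (\<alpha> j))"
  fix A assume A: "A \<subseteq> ?\<pi> ` X" "A \<noteq> {}" "A \<noteq> ?\<pi> ` X"
  let ?B = "{\<alpha> \<in> X. ?\<pi> \<alpha> \<in> A}"
  have "?B \<subseteq> X" "?B \<noteq> {}" "?B \<noteq> X" using A by auto
  from conn[unfolded exp_connected_def, rule_format, OF this]
  obtain \<alpha> \<beta> k l where \<alpha>\<beta>: "\<alpha> \<in> ?B" "\<beta> \<in> X - ?B" "\<alpha>(k := Suc (\<alpha> k)) = \<beta>(l := Suc (\<beta> l))"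
    by blast
  have eq: "\<alpha> m + (if m = k then 1 else 0) = \<beta> m + (if m = l then 1 else 0)" for m
    using fun_cong[OF \<alpha>\<beta>(3), of m] by (auto split: if_splits)
  have "?\<pi> \<alpha> \<in> A" "?\<pi> \<beta> \<in> ?\<pi> ` X - A" using \<alpha>\<beta> by auto
  moreover have "\<bar>int (\<alpha> i) - int (\<beta> i)\<bar> \<le> 1 \<and> \<bar>int (\<alpha> j) - int (\<beta> j)\<bar> \<le> 1 \<and>
      \<bar>(int (\<alpha> i) + int (\<alpha> j)) - (int (\<beta> i) + int (\<beta> j))\<bar> \<le> 1"
    using eq[of i] eq[of j] \<open>i \<noteq> j\<close> by (auto split: if_splits)
  ultimately show "\<exists>a b c d. (a, b) \<in> A \<and> (c, d) \<in> ?\<pi> ` X - A \<and>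
      \<bar>a - c\<bar> \<le> 1 \<and> \<bar>b - d\<bar> \<le> 1 \<and> \<bar>(a + b) - (c + d)\<bar> \<le> 1"
    by blast
qed

lemma unmixed_imp_nonzero:
  assumes "unmixed x y z" and "a > 0" and "b > 0" and "c > 0"
  shows "a * x + b * y + c * z \<noteq> 0"
proof -
  have "a * x + b * y + c * z > 0" if "0 \<le> x" "0 \<le> y" "0 \<le> z" "x \<noteq> 0 \<or> y \<noteq> 0 \<or> z \<noteq> 0" for x y z
    using that assms(2-4) by (smt (verit) mult_nonneg_nonneg mult_pos_pos)
  from this[of x y z] this[of "-x" "-y" "-z"] show ?thesis
    using assms(1) by (auto simp: unmixed_def)
qed

text \<open>The planar bound \<open>D + 6 \<le> 2 N(P)\<close> transferred to the variables
  \<open>i\<close> and \<open>j\<close>: distinct nodes of \<open>r\<close> lie under distinct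
  monomials of \<open>S Q\<close>.\<close>

lemma projected_extent:
  assumes n: "n \<ge> 2" and ij: "i \<le> n" "j \<le> n" "i \<noteq> j"
    and Q: "supp Q \<subseteq> exps n d" and conn: "exp_connected n (supp Q)"
    and \<alpha>\<beta>\<gamma>: "\<alpha> \<in> supp Q" "\<beta> \<in> supp Q" "\<gamma> \<in> supp Q"
  shows "\<alpha> i + \<alpha> j + 6 \<le> 2 * card (supp (mulS n Q)) + \<beta> i + \<gamma> j"
proof -
  define \<pi> where "\<pi> \<alpha> = (int (\<alpha> i), int (\<alpha> j))" for \<alpha> :: "nat \<Rightarrow> nat"
  define fib where "fib u = (\<lambda>\<alpha>. if \<pi> \<alpha> = u then Q \<alpha> else 0)" for u
  have fin: "finite (supp Q)" using Q finite_exps by (rule finite_subset)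
  have fib: "supp (fib u) = {\<alpha> \<in> supp Q. \<pi> \<alpha> = u}" for u by (auto simp: fib_def supp_def)
  have fibE: "supp (fib u) \<subseteq> exps n d" for u using fib Q by auto
  obtain x where x: "\<And>k. x k > 0" and gen: "\<And>u. u \<in> \<pi> ` supp Q \<Longrightarrow> peval n (fib u) x \<noteq> 0"
  proof (rule generic_positive_point[of "fib ` \<pi> ` supp Q" n])
    show "finite (fib ` \<pi> ` supp Q)" using fin by simp
    show "is_poly n g" if "g \<in> fib ` \<pi> ` supp Q" for g
      using that is_poly_if_supp_exps[OF fibE] by auto
    show "g \<noteq> (\<lambda>_. 0)" if "g \<in> fib ` \<pi> ` supp Q" for g
      using that by (auto simp: fib_def supp_def fun_eq_iff)
  qed blast
  define mon where "mon \<alpha> = (\<Prod>k\<le>n. x k ^ \<alpha> k)" for \<alpha> :: "nat \<Rightarrow> nat"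
  define \<phi> where "\<phi> u \<alpha> = (if \<pi> \<alpha> = u then mon \<alpha> else 0)" for u \<alpha>
  \<comment> \<open>The value at \<open>x\<close> of the part of \<open>Q\<close> over
    \<open>(a, b)\<close>, written as a pairing with \<open>\<phi>\<close> so that
    \<open>sum_mulS\<close> applies. Genericity of \<open>x\<close> makes it nonzero exactly over
    the projected support.\<close>
  define r where "r a b = (\<Sum>\<alpha>\<in>exps n d. Q \<alpha> * \<phi> (a, b) \<alpha>)" for a b
  have r_peval: "r a b = peval n (fib (a, b)) x" for a b
    unfolding r_def peval_eq_sum_exps[OF fibE] by (intro sum.cong) (auto simp: fib_def \<phi>_def mon_def)
  have W: "{(a, b). r a b \<noteq> 0} = \<pi> ` supp Q"
  proof (intro set_eqI iffI; clarify)
    fix a b assume "r a b \<noteq> 0"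
    then have "supp (fib (a, b)) \<noteq> {}" by (auto simp: r_peval peval_def)
    then obtain \<delta> where "\<delta> \<in> supp Q" "\<pi> \<delta> = (a, b)" unfolding fib by blast
    then show "(a, b) \<in> \<pi> ` supp Q" by (metis imageI)
  next
    fix a b \<delta> assume "\<delta> \<in> supp Q" "(a, b) = \<pi> \<delta>" "r a b = 0"
    then show False using gen[of "(a, b)"] r_peval by auto
  qed
  define s where "s = (\<Sum>k\<in>{..n} - {i} - {j}. x k)"
  \<comment> \<open>A third variable exists because \<open>n \<ge> 2\<close>; it gives the value at
    \<open>u\<close> itself the positive weight \<open>s\<close>.\<close>
  have "{..n} - {i} - {j} \<noteq> {}"
  proof
    assume "{..n} - {i} - {j} = {}"
    then have "card {..n} \<le> card {i, j}" by (intro card_mono) auto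
    also have "\<dots> \<le> 2" by (simp add: card_insert_if)
    finally show False using n by simp
  qed
  then have s: "s > 0" unfolding s_def using x by (intro sum_pos) auto
  \<comment> \<open>Multiplying by \<open>X_i\<close> or \<open>X_j\<close> moves to a neighbouring
    fibre, multiplying by any other variable stays in the fibre.\<close>
  have step: "(\<Sum>k\<le>n. \<phi> (a, b) (\<delta>(k := Suc (\<delta> k))))
      = x i * \<phi> (a - 1, b) \<delta> + x j * \<phi> (a, b - 1) \<delta> + s * \<phi> (a, b) \<delta>" for a b \<delta>
  proof -
    have mon: "mon (\<delta>(k := Suc (\<delta> k))) = x k * mon \<delta>" if "k \<le> n" for k
      unfolding mon_def using that by (rule prod_power_fun_upd_Suc)
    have "(\<Sum>k\<le>n. \<phi> (a, b) (\<delta>(k := Suc (\<delta> k)))) = \<phi> (a, b) (\<delta>(i := Suc (\<delta> i)))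
        + (\<phi> (a, b) (\<delta>(j := Suc (\<delta> j))) + (\<Sum>k\<in>{..n} - {i} - {j}. \<phi> (a, b) (\<delta>(k := Suc (\<delta> k)))))"
      using ij by (simp add: sum.remove[of "{..n}" i] sum.remove[of "{..n} - {i}" j])
    also have "\<phi> (a, b) (\<delta>(i := Suc (\<delta> i))) = x i * \<phi> (a - 1, b) \<delta>"
      using ij mon[of i] by (auto simp: \<phi>_def \<pi>_def)
    also have "\<phi> (a, b) (\<delta>(j := Suc (\<delta> j))) = x j * \<phi> (a, b - 1) \<delta>"
      using ij mon[of j] by (auto simp: \<phi>_def \<pi>_def)
    also have "(\<Sum>k\<in>{..n} - {i} - {j}. \<phi> (a, b) (\<delta>(k := Suc (\<delta> k)))) = s * \<phi> (a, b) \<delta>"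
      unfolding s_def sum_distrib_right using mon by (intro sum.cong) (auto simp: \<phi>_def \<pi>_def)
    finally show ?thesis by (simp only: add.assoc)
  qed
  have rec: "(\<Sum>\<beta>\<in>exps n (Suc d). mulS n Q \<beta> * \<phi> (a, b) \<beta>)
      = x i * r (a - 1) b + x j * r a (b - 1) + s * r a b" for a b
    unfolding sum_mulS step r_def sum_distrib_left sum.distrib[symmetric]
    by (rule sum.cong) (auto simp: algebra_simps)
  have "nodes r \<subseteq> \<pi> ` supp (mulS n Q)"
  proof
    fix u assume "u \<in> nodes r"
    then obtain a b where u: "u = (a, b)" and um: "unmixed (r a b) (r (a - 1) b) (r a (b - 1))"
      by (auto simp: nodes_def)
    from unmixed_imp_nonzero[OF um s x x, of i j]
    have "(\<Sum>\<beta>\<in>exps n (Suc d). mulS n Q \<beta> * \<phi> (a, b) \<beta>) \<noteq> 0"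
      unfolding rec by (simp add: algebra_simps)
    then obtain \<beta> where "mulS n Q \<beta> * \<phi> (a, b) \<beta> \<noteq> 0"
      by (elim sum.not_neutral_contains_not_neutral)
    then have "\<beta> \<in> supp (mulS n Q)" "\<pi> \<beta> = u"
      unfolding u by (auto simp: supp_def \<phi>_def split: if_splits)
    then show "u \<in> \<pi> ` supp (mulS n Q)" by blast
  qed
  moreover have finS: "finite (supp (mulS n Q))"
    using supp_mulS[OF Q] finite_exps by (rule finite_subset)
  ultimately have "card (nodes r) \<le> card (\<pi> ` supp (mulS n Q))" by (intro card_mono) auto
  also have "\<dots> \<le> card (supp (mulS n Q))" using finS by (rule card_image_le)
  finally have nodes: "card (nodes r) \<le> card (supp (mulS n Q))" .
  have "tri_connected (\<pi> ` supp Q)"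
    using tri_connected_projection[OF conn ij(3)] by (simp add: \<pi>_def[abs_def])
  then have "fst (\<pi> \<alpha>) + snd (\<pi> \<alpha>) - fst (\<pi> \<beta>) - snd (\<pi> \<gamma>) + 6 \<le> 2 * int (card (nodes r))"
    using \<alpha>\<beta>\<gamma> fin by (intro nodes_extent) (simp_all add: W)
  then show ?thesis using nodes by (simp add: \<pi>_def)
qed

section \<open>The p-degree and the sum of the planar bounds\<close>

lemma pdegree_le:
  assumes P: "supp P \<subseteq> exps n m" and \<mu>: "\<And>\<alpha> i. \<alpha> \<in> supp P \<Longrightarrow> \<mu> i \<le> \<alpha> i" and \<mu>0: "\<And>i. i > n \<Longrightarrow> \<mu> i = 0"
  shows "pdegree n P \<le> m - tdeg n \<mu>"
proof -
  define R where "R = (\<lambda>\<alpha>. P (\<lambda>i. \<alpha> i + \<mu> i))"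
  have PR: "P = mono_mult \<mu> R"
  proof
    fix \<alpha>
    show "P \<alpha> = mono_mult \<mu> R \<alpha>"
    proof (cases "\<forall>i. \<mu> i \<le> \<alpha> i")
      case True
      then show ?thesis by (simp add: mono_mult_def R_def)
    next
      case False
      then have "P \<alpha> = 0" using \<mu> by (auto simp: supp_def)
      then show ?thesis using False by (auto simp: mono_mult_def)
    qed
  qed
  have R: "supp R \<subseteq> exps n (m - tdeg n \<mu>)"
  proof
    fix \<alpha> assume "\<alpha> \<in> supp R"
    then have "(\<lambda>i. \<alpha> i + \<mu> i) \<in> exps n m" using P by (auto simp: supp_def R_def)
    then show "\<alpha> \<in> exps n (m - tdeg n \<mu>)" by (auto simp: exps_def tdeg_def sum.distrib)
  qed
  have "pdegree n P \<le> poly_degree n R"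
    unfolding pdegree_def using is_poly_if_supp_exps[OF R] \<mu>0 PR by (intro Least_le) blast
  also have "finite (supp R)" using R finite_exps by (rule finite_subset)
  then have "poly_degree n R \<le> m - tdeg n \<mu>"
    unfolding poly_degree_def using R by (subst Max_le_iff) (auto simp: exps_def)
  finally show ?thesis .
qed

theorem mainTheorem17:
  fixes n :: nat and P :: "(nat \<Rightarrow> nat) \<Rightarrow> real"
  assumes "n \<ge> 2"
    and "in_I n P"
    and "P \<noteq> (\<lambda>_. 0)"
    and "indecomposable n P"
  shows "real (pdegree n P) \<le> (real n - 1) * (2 * real (Nmon P) - 5)"
proof -
  obtain m where Pm: "supp P \<subseteq> exps n m"
    using assms(2) unfolding in_I_def homogeneous_def is_poly_def exps_def by auto
  \<comment> \<open>A nonzero constant does not vanish at the origin, which lies on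
    \<open>S = 0\<close>; so there is a degree to lose on division by \<open>S\<close>.\<close>
  have "m \<noteq> 0"
  proof
    assume "m = 0"
    have "supp P \<subseteq> {\<lambda>_. 0}"
    proof
      fix \<alpha> assume "\<alpha> \<in> supp P"
      then have "\<alpha> \<in> exps n 0" using Pm \<open>m = 0\<close> by blast
      then have "\<alpha> i = 0" for i by (cases "i \<le> n") (auto simp: exps_def tdeg_def)
      then show "\<alpha> \<in> {\<lambda>_. 0}" by auto
    qed
    moreover have "supp P \<noteq> {}" using assms(3) by (auto simp: supp_def)
    ultimately have "supp P = {\<lambda>_. 0}" by blast
    then have "peval n P (\<lambda>_. 0) \<noteq> 0" by (auto simp: peval_def supp_def)
    then show False using assms(2) by (simp add: in_I_def)
  qed
  then obtain d where "m = Suc d" using not0_implies_Suc by blast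
  with Pm have PE: "supp P \<subseteq> exps n (Suc d)" by simp
  obtain Q where Q: "supp Q \<subseteq> exps n d" and PQ: "P = mulS n Q"
    using in_I_factor[OF assms(2) PE] .
  have "supp P \<noteq> {}" using assms(3) by (auto simp: supp_def)
  then have "supp Q \<noteq> {}" unfolding PQ by (auto elim: supp_mulSE)
  have fin: "finite (supp Q)" using Q finite_exps by (rule finite_subset)
  have conn: "exp_connected n (supp Q)"
    using indecomposable_imp_exp_connected assms(4) Q unfolding PQ by blast
  define \<mu> where "\<mu> i = Min ((\<lambda>\<alpha>. \<alpha> i) ` supp Q)" for i
  have \<mu>_le: "\<mu> i \<le> \<alpha> i" if "\<alpha> \<in> supp Q" for \<alpha> i
    unfolding \<mu>_def using that fin by (intro Min_le) auto
  have \<mu>_attained: "\<exists>\<alpha>\<in>supp Q. \<alpha> i = \<mu> i" for i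
  proof -
    have "\<mu> i \<in> (\<lambda>\<alpha>. \<alpha> i) ` supp Q"
      unfolding \<mu>_def using fin \<open>supp Q \<noteq> {}\<close> by (intro Min_in) auto
    then show ?thesis by (metis imageE)
  qed
  define L where "L = 2 * int (Nmon P) - 6"
  \<comment> \<open>Choosing \<open>\<alpha>\<close> minimal in the last variable makes
    \<open>y n = 0\<close>, which saves one summand.\<close>
  obtain \<alpha> where \<alpha>: "\<alpha> \<in> supp Q" "\<alpha> n = \<mu> n" using \<mu>_attained by blast
  define y where "y i = int (\<alpha> i) - int (\<mu> i)" for i
  have y0: "0 \<le> y i" for i using \<mu>_le[OF \<alpha>(1), of i] by (simp add: y_def)
  have yL: "y i + y j \<le> L" if "i \<le> n" "j \<le> n" "i \<noteq> j" for i j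
  proof -
    obtain \<beta> \<gamma> where "\<beta> \<in> supp Q" "\<beta> i = \<mu> i" "\<gamma> \<in> supp Q" "\<gamma> j = \<mu> j" using \<mu>_attained by metis
    then show ?thesis using projected_extent[OF assms(1) that Q conn \<alpha>(1), of \<beta> \<gamma>]
      by (simp add: y_def L_def Nmon_def PQ)
  qed
  have yL1: "y i \<le> L" if "i \<le> n" "i \<noteq> 0" for i using yL[of 0 i] y0[of 0] that by simp
  have "(\<Sum>i\<le>n. y i) = (\<Sum>i<n. y i)"
    by (simp add: lessThan_Suc_atMost[symmetric] y_def \<alpha>(2))
  \<comment> \<open>The variables 0 and 1 together cost at most \<open>L\<close>, and each of the
    other \<open>n - 2\<close> costs at most \<open>L\<close>: in total
    \<open>(n - 1) * L\<close>.\<close>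
  also have "\<dots> = y 0 + y 1 + (\<Sum>i\<in>{2..<n}. y i)"
    using assms(1) by (simp add: lessThan_atLeast0 sum.atLeast_Suc_lessThan numeral_2_eq_2)
  also have "\<dots> \<le> L + (\<Sum>i\<in>{2..<n}. L)"
    using assms(1) yL[of 0 1] yL1 by (intro add_mono sum_mono) auto
  also have "\<dots> = (int n - 1) * L" using assms(1) by (simp add: algebra_simps of_nat_diff)
  finally have "(\<Sum>i\<le>n. y i) \<le> (int n - 1) * L" .
  moreover have "(\<Sum>i\<le>n. y i) = int d - int (tdeg n \<mu>)"
    using Q \<alpha>(1) by (auto simp: y_def sum_subtractf exps_def tdeg_def)
  moreover have "tdeg n \<mu> \<le> d"
    using Q \<alpha>(1) \<mu>_le[OF \<alpha>(1)] by (auto simp: exps_def tdeg_def intro!: sum_mono)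
  \<comment> \<open>Each exponent of \<open>P\<close> is one of \<open>Q\<close> raised by 1 in a
    single variable, so the monomial \<open>\<mu>\<close> also divides \<open>P\<close>; the degree
    is \<open>Suc d\<close> instead of \<open>d\<close>.\<close>
  moreover have "pdegree n P \<le> Suc d - tdeg n \<mu>"
  proof (rule pdegree_le[OF PE])
    show "\<mu> i \<le> \<beta> i" if "\<beta> \<in> supp P" for \<beta> i
      using that unfolding PQ by (elim supp_mulSE) (auto intro: \<mu>_le le_SucI)
    show "\<mu> i = 0" if "i > n" for i
      using \<mu>_le[OF \<alpha>(1), of i] \<alpha>(1) Q that by (auto simp: exps_def)
  qed
  ultimately have "int (pdegree n P) \<le> (int n - 1) * L + 1" by linarith
  \<comment> \<open>The additional 1 is absorbed since \<open>n - 1 \<ge> 1\<close>, turning the 6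
    of \<open>L\<close> into 5.\<close>
  also have "\<dots> \<le> (int n - 1) * (2 * int (Nmon P) - 5)"
    using assms(1) by (simp add: L_def algebra_simps)
  finally have "real_of_int (int (pdegree n P)) \<le> real_of_int ((int n - 1) * (2 * int (Nmon P) - 5))"
    by (simp only: of_int_le_iff)
  then show ?thesis by simp
qed

end
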